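(* Let $\mathcal H,\mathcal K$ be complex Hilbert spaces and let $A,B\in L(\mathcal H,\mathcal K)$. The following implications hold: 1. $A\overset{*}{\leq}B\Rightarrow A\overset{-}{\leq}B\Rightarrow A\overset{+}{\leq}B\Rightarrow A\overset{s}{\leq}B$. 2. $A\overset{*}{\leq}B\Rightarrow A\overset{\diamond}{\leq}B\Rightarrow A\overset{+}{\leq}B\Rightarrow A\overset{s}{\leq}B$.
   Context: $L(\mathcal H,\mathcal K)$ is the set of bounded linear operators from $\mathcal H$ to $\mathcal K$, $L(\mathcal H)=L(\mathcal H,\mathcal H)$; $R(T)$ is the range of $T$. A projection is a bounded idempotent operator (not necessarily orthogonal). For $A,B\in L(\mathcal H,\mathcal K)$: - $A\overset{s}{\leq}B$ (space pre-order) if $R(A)\subseteq R(B)$ and $R(A^* )\subseteq R(B^* )$; - $A\overset{*}{\leq}B$ (star order) if $A^*A=A^*B$ and $AA^*=BA^*$; - $A\overset{\diamond}{\leq}B$ (diamond order) if $A\overset{s}{\leq}B$ and $AA^*A=AB^*A$; - $A\overset{-}{\leq}B$ (minus order) if there are projections $\tilde Q\in L(\mathcal K)$ and $Q\in L(\mathcal H)$ such that $A=\tilde QB=BQ$; - $A\overset{+}{\leq}B$ (plus order) if $A\overset{s}{\leq}B$ and there are projections $\tilde Q\in L(\mathcal K)$ and $Q\in L(\mathcal H)$ such that $A=\tilde QBQ$. *)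

theory Defs
  imports "HOL-Analysis.Analysis"
begin

class complex_vector = real_vector +
  fixes scaleC :: "complex \<Rightarrow> 'a \<Rightarrow> 'a" (infixr "*\<^sub>C" 75)
  assumes scaleC_add_right: "c *\<^sub>C (x + y) = c *\<^sub>C x + c *\<^sub>C y"
    and scaleC_add_left: "(c + d) *\<^sub>C x = c *\<^sub>C x + d *\<^sub>C x"
    and scaleC_scaleC: "c *\<^sub>C (d *\<^sub>C x) = (c * d) *\<^sub>C x"
    and scaleC_one: "1 *\<^sub>C x = x"
    and scaleR_scaleC: "r *\<^sub>R x = complex_of_real r *\<^sub>C x"

text \<open>The complex inner product is linear in its first argument. The norm and topology are
  those of \<^class>\<open>real_inner\<close>, whose inner product is required to be the real part of the
  complex one, so that the norm of \<open>x\<close> is the square root of \<open>cinner x x\<close>.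
  Positive definiteness of \<open>cinner\<close> follows from that of the real inner product, because
  \<open>cinner x x\<close> is real by conjugate symmetry.\<close>

class complex_inner = complex_vector + real_inner +
  fixes cinner :: "'a \<Rightarrow> 'a \<Rightarrow> complex"
  assumes cinner_commute: "cinner x y = cnj (cinner y x)"
    and cinner_add_left: "cinner (x + y) z = cinner x z + cinner y z"
    and cinner_scaleC_left: "cinner (c *\<^sub>C x) y = c * cinner x y"
    and inner_eq_Re_cinner: "inner x y = Re (cinner x y)"

class chilbert_space = complex_inner + complete_space

instantiation complex :: chilbert_space
begin

definition scaleC_complex :: "complex \<Rightarrow> complex \<Rightarrow> complex" where
  "scaleC_complex c z = c * z"

definition cinner_complex :: "complex \<Rightarrow> complex \<Rightarrow> complex" where
  "cinner_complex z w = z * cnj w"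

instance
  by standard
    (auto simp: scaleC_complex_def cinner_complex_def algebra_simps scaleR_conv_of_real
      inner_complex_def)

end

definition bounded_clinear :: "('a::complex_inner \<Rightarrow> 'b::complex_inner) \<Rightarrow> bool" where
  "bounded_clinear T \<longleftrightarrow> bounded_linear T \<and> (\<forall>c x. T (c *\<^sub>C x) = c *\<^sub>C T x)"

text \<open>For bounded complex-linear operators between Hilbert spaces the operator described here
  exists (by the Riesz representation theorem) and is unique.\<close>

definition cadjoint :: "('a::chilbert_space \<Rightarrow> 'b::chilbert_space) \<Rightarrow> 'b \<Rightarrow> 'a" where
  "cadjoint T = (THE S. \<forall>x y. cinner (T x) y = cinner x (S y))"

text \<open>Projections are idempotents, not necessarily orthogonal.\<close>

definition is_projection :: "('a::complex_inner \<Rightarrow> 'a) \<Rightarrow> bool" where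
  "is_projection Q \<longleftrightarrow> bounded_clinear Q \<and> Q \<circ> Q = Q"

definition space_le :: "('a::chilbert_space \<Rightarrow> 'b::chilbert_space) \<Rightarrow> ('a \<Rightarrow> 'b) \<Rightarrow> bool" where
  "space_le A B \<longleftrightarrow> range A \<subseteq> range B \<and> range (cadjoint A) \<subseteq> range (cadjoint B)"

definition star_le :: "('a::chilbert_space \<Rightarrow> 'b::chilbert_space) \<Rightarrow> ('a \<Rightarrow> 'b) \<Rightarrow> bool" where
  "star_le A B \<longleftrightarrow>
     cadjoint A \<circ> A = cadjoint A \<circ> B \<and> A \<circ> cadjoint A = B \<circ> cadjoint A"

definition diamond_le :: "('a::chilbert_space \<Rightarrow> 'b::chilbert_space) \<Rightarrow> ('a \<Rightarrow> 'b) \<Rightarrow> bool" where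
  "diamond_le A B \<longleftrightarrow> space_le A B \<and> A \<circ> cadjoint A \<circ> A = A \<circ> cadjoint B \<circ> A"

definition minus_le :: "('a::chilbert_space \<Rightarrow> 'b::chilbert_space) \<Rightarrow> ('a \<Rightarrow> 'b) \<Rightarrow> bool" where
  "minus_le A B \<longleftrightarrow>
     (\<exists>Q' Q. is_projection Q' \<and> is_projection Q \<and> A = Q' \<circ> B \<and> A = B \<circ> Q)"

definition plus_le :: "('a::chilbert_space \<Rightarrow> 'b::chilbert_space) \<Rightarrow> ('a \<Rightarrow> 'b) \<Rightarrow> bool" where
  "plus_le A B \<longleftrightarrow> space_le A B \<and>
     (\<exists>Q' Q. is_projection Q' \<and> is_projection Q \<and> A = Q' \<circ> B \<circ> Q)"

end

theory Submission imports Defs begin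

text \<open>The equation \<open>A\<^sup>* A = A\<^sup>* B\<close> says that \<open>B - A\<close> maps into the orthogonal complement of \<open>R(A)\<close>,
  and \<open>A A\<^sup>* = B A\<^sup>*\<close> says that \<open>B - A\<close> vanishes on \<open>R(A\<^sup>*)\<close>; hence the star order gives
  \<open>A = P B = B Q\<close> with \<open>P\<close> and \<open>Q\<close> the orthogonal projections onto the closures of \<open>R(A)\<close> and
  \<open>R(A\<^sup>*)\<close>. The adjoint of \<open>A A\<^sup>* A = A B\<^sup>* A\<close> says \<open>P (B - A) Q = 0\<close>, so the diamond order gives
  \<open>A = P B Q\<close> with the same projections.\<close>

section \<open>Complex inner products\<close>

lemma cinner_add_right: "cinner x (y + z) = cinner x y + cinner x (z::'a::complex_inner)"
  by (subst (1 2 3) cinner_commute) (simp add: cinner_add_left)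

lemma cinner_scaleC_right: "cinner x (c *\<^sub>C y) = cnj c * cinner x (y::'a::complex_inner)"
  by (subst (1 2) cinner_commute) (simp add: cinner_scaleC_left)

lemma cinner_zero_left [simp]: "cinner 0 (y::'a::complex_inner) = 0"
  using cinner_add_left[of 0 0 y] by simp

lemma cinner_zero_right [simp]: "cinner (y::'a::complex_inner) 0 = 0"
  using cinner_add_right[of y 0 0] by simp

lemma cinner_diff_left: "cinner (x - y) z = cinner x z - cinner y (z::'a::complex_inner)"
  using cinner_add_left[of "x - y" y z] by simp

lemma cinner_diff_right: "cinner x (y - z) = cinner x y - cinner x (z::'a::complex_inner)"
  using cinner_add_right[of x "y - z" z] by simp

lemma cinner_self_eq_0_iff: "cinner x x = 0 \<longleftrightarrow> x = (0::'a::complex_inner)"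
  using inner_eq_Re_cinner[of x x] by auto

lemma cinner_eq_0_commute: "cinner x y = 0 \<longleftrightarrow> cinner y (x::'a::complex_inner) = 0"
  by (subst cinner_commute) simp

lemma cinner_left_ext:
  fixes x y :: "'a::complex_inner"
  assumes "\<And>z. cinner x z = cinner y z"
  shows "x = y"
  using assms[of "x - y"] cinner_self_eq_0_iff[of "x - y"] by (simp add: cinner_diff_left)

lemma cinner_right_ext:
  fixes x y :: "'a::complex_inner"
  assumes "\<And>z. cinner z x = cinner z y"
  shows "x = y"
  using assms[of "x - y"] cinner_self_eq_0_iff[of "x - y"] by (simp add: cinner_diff_right)

text \<open>Carries real facts over to \<open>cinner\<close>: both its real and its imaginary part
  are real inner products, the latter with the second argument rotated by
  \<open>\<i>\<close>.\<close>

lemma Im_cinner: "Im (cinner x y) = inner x (\<i> *\<^sub>C (y::'a::complex_inner))"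
  by (simp add: inner_eq_Re_cinner cinner_scaleC_right)

lemma scaleC_diff_right: "c *\<^sub>C (x - y) = c *\<^sub>C x - c *\<^sub>C (y::'a::complex_vector)"
  using scaleC_add_right[of c "x - y" y] by simp

lemma norm_scaleC: "norm (c *\<^sub>C x) = cmod c * norm (x::'a::complex_inner)"
proof -
  have "Im (cinner x x) = 0"
    using arg_cong[OF cinner_commute[of x x], of Im] by simp
  then have "inner (c *\<^sub>C x) (c *\<^sub>C x) = (cmod c)\<^sup>2 * inner x x"
    unfolding cmod_power2
    by (simp add: inner_eq_Re_cinner cinner_scaleC_right cinner_scaleC_left
        power2_eq_square algebra_simps)
  then have "(norm (c *\<^sub>C x))\<^sup>2 = (cmod c * norm x)\<^sup>2"
    by (simp add: power2_norm_eq_inner power_mult_distrib)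
  then show ?thesis
    by (simp add: power2_eq_iff_nonneg)
qed

lemma bounded_linear_scaleC: "bounded_linear ((*\<^sub>C) c :: 'a::complex_inner \<Rightarrow> 'a)"
proof (rule bounded_linear_intro)
  show "c *\<^sub>C (r *\<^sub>R x) = r *\<^sub>R c *\<^sub>C x" for r and x :: 'a
    by (simp add: scaleR_scaleC scaleC_scaleC mult.commute)
  show "norm (c *\<^sub>C x) \<le> norm x * cmod c" for x :: 'a
    by (simp add: norm_scaleC)
qed (rule scaleC_add_right)

lemma bounded_linear_cinner_left: "bounded_linear (\<lambda>x::'a::complex_inner. cinner x y)"
proof (rule bounded_linear_intro)
  show "cinner (r *\<^sub>R x) y = r *\<^sub>R cinner x y" for r x
    by (simp add: scaleR_scaleC cinner_scaleC_left scaleC_complex_def)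
  \<comment> \<open>The constant comes from bounding the modulus by |Re| + |Im| and applying the
    real Cauchy-Schwarz inequality to each part.\<close>
  show "norm (cinner x y) \<le> norm x * (norm y + norm (\<i> *\<^sub>C y))" for x
  proof -
    have "norm (cinner x y) \<le> \<bar>inner x y\<bar> + \<bar>inner x (\<i> *\<^sub>C y)\<bar>"
      using cmod_le[of "cinner x y"] by (simp add: Im_cinner inner_eq_Re_cinner)
    also have "\<dots> \<le> norm x * norm y + norm x * norm (\<i> *\<^sub>C y)"
      by (intro add_mono Cauchy_Schwarz_ineq2)
    finally show ?thesis by (simp add: distrib_left)
  qed
qed (rule cinner_add_left)

section \<open>Bounded complex-linear operators\<close>

lemma
  assumes "bounded_clinear T"
  shows bounded_clinear_bounded_linear: "bounded_linear T"
    and bounded_clinear_add: "T (x + y) = T x + T y"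
    and bounded_clinear_diff: "T (x - y) = T x - T y"
    and bounded_clinear_scaleC: "T (c *\<^sub>C x) = c *\<^sub>C T x"
  using assms unfolding bounded_clinear_def
  by (auto intro: linear_add linear_diff bounded_linear.linear)

lemma bounded_clinear_sub:
  assumes "bounded_clinear S" and "bounded_clinear T"
  shows "bounded_clinear (\<lambda>x. S x - T x)"
  using assms unfolding bounded_clinear_def by (simp add: bounded_linear_sub scaleC_diff_right)

lemma bounded_clinear_compose:
  assumes "bounded_clinear S" and "bounded_clinear T"
  shows "bounded_clinear (\<lambda>x. S (T x))"
  using assms unfolding bounded_clinear_def by (simp add: bounded_linear_compose)

text \<open>The kernel of a continuous operator is closed.\<close>

lemma bounded_clinear_zero_on_closure:
  assumes "bounded_clinear T" and "\<And>x. x \<in> S \<Longrightarrow> T x = 0" and "x \<in> closure S"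
  shows "T x = 0"
proof -
  have "closed {x. T x = 0}"
    using assms(1)
    by (intro closed_Collect_eq continuous_intros bounded_linear.continuous_on[where g = "\<lambda>x. x"]
        bounded_clinear_bounded_linear)
  then have "closure S \<subseteq> {x. T x = 0}"
    using assms(2) by (intro closure_minimal) auto
  then show ?thesis using assms(3) by blast
qed

section \<open>Complex subspaces, their ranges and closures\<close>

definition csubspace :: "'a::complex_vector set \<Rightarrow> bool" where
  "csubspace S \<longleftrightarrow> 0 \<in> S \<and> (\<forall>x\<in>S. \<forall>y\<in>S. x + y \<in> S) \<and> (\<forall>c. \<forall>x\<in>S. c *\<^sub>C x \<in> S)"

lemma csubspace_imp_subspace: "csubspace S \<Longrightarrow> subspace S"
  by (auto simp: csubspace_def subspace_def scaleR_scaleC)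

lemma csubspace_diff: "csubspace S \<Longrightarrow> x \<in> S \<Longrightarrow> y \<in> S \<Longrightarrow> x - y \<in> S"
  by (blast intro: subspace_diff csubspace_imp_subspace)

text \<open>Stated for additive and homogeneous maps, so that it covers \<open>cadjoint T\<close>,
  for which only linearity is derived.\<close>

lemma csubspace_range:
  assumes "\<And>x y. T (x + y) = T x + T y" and "\<And>c x. T (c *\<^sub>C x) = c *\<^sub>C T x"
  shows "csubspace (range T)"
proof -
  have "T 0 = 0"
    using assms(1)[of 0 0] by simp
  then show ?thesis
    unfolding csubspace_def by (auto simp flip: assms intro: range_eqI[OF sym])
qed

lemma csubspace_closure:
  fixes S :: "'a::complex_inner set"
  assumes "csubspace S"
  shows "csubspace (closure S)"
proof -
  have "0 \<in> closure S"
    using assms closure_subset unfolding csubspace_def by blast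
  moreover have "x + y \<in> closure S" if x: "x \<in> closure S" and y: "y \<in> closure S" for x y
  proof -
    obtain f where f: "\<forall>n::nat. f n \<in> S" "f \<longlonglongrightarrow> x"
      using x unfolding closure_sequential by blast
    obtain g where g: "\<forall>n::nat. g n \<in> S" "g \<longlonglongrightarrow> y"
      using y unfolding closure_sequential by blast
    have "\<forall>n. f n + g n \<in> S"
      using assms f(1) g(1) by (simp add: csubspace_def)
    with tendsto_add[OF f(2) g(2)] show ?thesis
      unfolding closure_sequential by (intro exI[of _ "\<lambda>n. f n + g n"] conjI)
  qed
  moreover have "c *\<^sub>C x \<in> closure S" if "x \<in> closure S" for c x
  proof -
    have "c *\<^sub>C x \<in> closure ((*\<^sub>C) c ` S)"
      using closure_bounded_linear_image_subset[OF bounded_linear_scaleC] that by blast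
    also have "\<dots> \<subseteq> closure S"
      using assms by (intro closure_mono) (auto simp: csubspace_def)
    finally show ?thesis .
  qed
  ultimately show ?thesis
    by (simp add: csubspace_def)
qed

section \<open>Orthogonal projections\<close>

text \<open>The Hilbert projection theorem over the reals: a sequence in \<open>S\<close> minimizing
  the distance to \<open>x\<close> is Cauchy by the parallelogram law, and minimality at its limit
  forces orthogonality.\<close>

lemma closed_subspace_orthogonal_decomposition:
  fixes S :: "'a::{real_inner,complete_space} set"
  assumes "closed S" and S: "subspace S"
  obtains p where "p \<in> S" and "\<And>s. s \<in> S \<Longrightarrow> inner (x - p) s = 0"
proof -
  define d where "d = (INF s\<in>S. (norm (x - s))\<^sup>2)"
  have bdd: "bdd_below ((\<lambda>s. (norm (x - s))\<^sup>2) ` S)"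
    by (rule bdd_belowI2[of _ 0]) simp
  have ne: "S \<noteq> {}"
    using S subspace_0 by blast
  have d_le: "d \<le> (norm (x - s))\<^sup>2" if "s \<in> S" for s
    unfolding d_def using bdd that by (rule cINF_lower)
  have "\<exists>s\<in>S. (norm (x - s))\<^sup>2 < d + inverse (Suc n)" for n
    using cINF_less_iff[OF ne bdd, of "d + inverse (Suc n)"] unfolding d_def by simp
  then obtain f where f: "\<And>n. f n \<in> S" and f_less: "\<And>n. (norm (x - f n))\<^sup>2 < d + inverse (Suc n)"
    by metis
  \<comment> \<open>Parallelogram law for \<open>x - p\<close> and \<open>x - q\<close>: the
    midpoint of \<open>p\<close> and \<open>q\<close> lies in \<open>S\<close>, so its squared
    distance to \<open>x\<close> is at least \<open>d\<close>, and 2(d + e) + 2(d + e) - 4d =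
    4e.\<close>
  have dist_f: "(norm (p - q))\<^sup>2 \<le> 4 * e"
    if "p \<in> S" "q \<in> S" "(norm (x - p))\<^sup>2 \<le> d + e" "(norm (x - q))\<^sup>2 \<le> d + e" for p q e
  proof -
    have "(1/2) *\<^sub>R (p + q) \<in> S"
      using that S by (simp add: subspace_add subspace_scale)
    note le = d_le[OF this]
    have "(norm (p - q))\<^sup>2 = 2 * (norm (x - p))\<^sup>2 + 2 * (norm (x - q))\<^sup>2
        - 4 * (norm (x - (1/2) *\<^sub>R (p + q)))\<^sup>2"
      by (simp add: power2_norm_eq_inner algebra_simps inner_commute)
    then show ?thesis using that le by linarith
  qed
  have "Cauchy f"
  proof (rule metric_CauchyI)
    fix e :: real assume "e > 0"
    then have "e\<^sup>2 / 4 > 0" by simp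
    then obtain N where N: "inverse (Suc N) < e\<^sup>2 / 4"
      using reals_Archimedean by blast
    have near: "(norm (x - f n))\<^sup>2 \<le> d + inverse (Suc N)" if "n \<ge> N" for n
    proof -
      have "inverse (real (Suc n)) \<le> inverse (real (Suc N))"
        using that by (intro le_imp_inverse_le) auto
      then show ?thesis using f_less[of n] by linarith
    qed
    have "dist (f m) (f n) < e" if "m \<ge> N" "n \<ge> N" for m n
    proof -
      have "(norm (f m - f n))\<^sup>2 \<le> 4 * inverse (Suc N)"
        by (intro dist_f f near that)
      also have "\<dots> < e\<^sup>2" using N by simp
      finally show ?thesis
        using \<open>e > 0\<close> by (simp add: dist_norm power2_less_imp_less)
    qed
    then show "\<exists>M. \<forall>m\<ge>M. \<forall>n\<ge>M. dist (f m) (f n) < e" by blast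
  qed
  then obtain p where p: "f \<longlonglongrightarrow> p"
    by (auto simp: Cauchy_convergent_iff convergent_def)
  have "p \<in> S"
    using \<open>closed S\<close> f p by (rule closed_sequentially)
  \<comment> \<open>Passing to the limit, \<open>p\<close> attains the infimum.\<close>
  have "(norm (x - p))\<^sup>2 \<le> d"
  proof (rule LIMSEQ_le)
    show "(\<lambda>n. (norm (x - f n))\<^sup>2) \<longlonglongrightarrow> (norm (x - p))\<^sup>2"
      by (intro tendsto_intros p)
    show "(\<lambda>n. d + inverse (Suc n)) \<longlonglongrightarrow> d"
      using tendsto_add[OF tendsto_const LIMSEQ_inverse_real_of_nat, of d] by simp
    show "\<exists>N. \<forall>n\<ge>N. (norm (x - f n))\<^sup>2 \<le> d + inverse (Suc n)"
      using f_less less_imp_le by blast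
  qed
  have "inner (x - p) s = 0" if "s \<in> S" for s
  proof (cases "s = 0")
    case False
    \<comment> \<open>Moving \<open>p\<close> by the component of \<open>x - p\<close> along \<open>s\<close> would decrease the distance.\<close>
    define t where "t = inner (x - p) s / inner s s"
    have "p + t *\<^sub>R s \<in> S"
      using \<open>p \<in> S\<close> that S by (simp add: subspace_add subspace_scale)
    then have "(norm (x - p))\<^sup>2 \<le> (norm (x - (p + t *\<^sub>R s)))\<^sup>2"
      using d_le \<open>(norm (x - p))\<^sup>2 \<le> d\<close> order_trans by blast
    also have "\<dots> = (norm (x - p))\<^sup>2 - 2 * t * inner (x - p) s + t * (t * inner s s)"
      by (simp add: power2_norm_eq_inner algebra_simps inner_commute)
    also have "t * inner s s = inner (x - p) s"
      using False by (simp add: t_def)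
    finally have "t * inner (x - p) s \<le> 0" by simp
    moreover have "t * inner (x - p) s = (inner (x - p) s)\<^sup>2 / inner s s"
      by (simp add: t_def power2_eq_square)
    ultimately have "(inner (x - p) s)\<^sup>2 \<le> 0"
      using False by (simp add: divide_le_0_iff not_le flip: inner_gt_zero_iff)
    then show ?thesis by simp
  qed simp
  with \<open>p \<in> S\<close> show ?thesis by (rule that)
qed

text \<open>Together with \<open>s\<close> a complex subspace contains
  \<open>\<i> *\<^sub>C s\<close>; real orthogonality to these two vectors kills the real and the
  imaginary part of \<open>cinner (x - p) s\<close>.\<close>

lemma closed_csubspace_orthogonal_decomposition:
  fixes S :: "'a::chilbert_space set"
  assumes "closed S" and S: "csubspace S"
  obtains p where "p \<in> S" and "\<And>s. s \<in> S \<Longrightarrow> cinner (x - p) s = 0"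
proof -
  obtain p where "p \<in> S" and p: "\<And>s. s \<in> S \<Longrightarrow> inner (x - p) s = 0"
    using closed_subspace_orthogonal_decomposition[OF assms(1) csubspace_imp_subspace[OF S]]
    by blast
  have "cinner (x - p) s = 0" if "s \<in> S" for s
    using p[OF that] p[of "\<i> *\<^sub>C s"] that S
    by (simp add: complex_eq_iff Im_cinner csubspace_def flip: inner_eq_Re_cinner)
  with \<open>p \<in> S\<close> show ?thesis by (rule that)
qed

text \<open>The foot of the perpendicular is unique, so additivity, homogeneity and idempotence of
  \<open>P\<close> each reduce to checking that the proposed value lies in \<open>S\<close> and
  leaves a residue orthogonal to \<open>S\<close>.\<close>

lemma orthogonal_projection_exists:
  fixes S :: "'a::chilbert_space set"
  assumes "closed S" and S: "csubspace S"
  obtains P where "is_projection P" and "\<And>x. P x \<in> S" and "\<And>x s. s \<in> S \<Longrightarrow> cinner (x - P x) s = 0"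
proof -
  have "\<exists>p. p \<in> S \<and> (\<forall>s\<in>S. cinner (x - p) s = 0)" for x
    by (rule closed_csubspace_orthogonal_decomposition[OF assms, of x]) blast
  then have "\<exists>P. \<forall>x. P x \<in> S \<and> (\<forall>s\<in>S. cinner (x - P x) s = 0)"
    by (intro choice allI)
  then obtain P where PS: "\<And>x. P x \<in> S" and orth: "\<And>x s. s \<in> S \<Longrightarrow> cinner (x - P x) s = 0"
    by blast
  have unique: "P x = p" if "p \<in> S" "\<And>s. s \<in> S \<Longrightarrow> cinner (x - p) s = 0" for x p
  proof -
    \<comment> \<open>The difference of two feet lies in \<open>S\<close> and is also a difference
      of residues, hence is orthogonal to itself.\<close>
    have "P x - p \<in> S" using PS S that(1) by (simp add: csubspace_diff)
    then have "cinner ((x - p) - (x - P x)) (P x - p) = 0"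
      unfolding cinner_diff_left[of "x - p"] using that(2) orth by simp
    then show ?thesis by (simp add: cinner_self_eq_0_iff)
  qed
  have add: "P (x + y) = P x + P y" for x y
  proof (rule unique)
    show "P x + P y \<in> S" using S PS by (simp add: csubspace_def)
    show "cinner (x + y - (P x + P y)) s = 0" if "s \<in> S" for s
      using orth[OF that, of x] orth[OF that, of y]
      by (simp add: cinner_diff_left cinner_add_left)
  qed
  have scale: "P (c *\<^sub>C x) = c *\<^sub>C P x" for c x
  proof (rule unique)
    show "c *\<^sub>C P x \<in> S" using S PS by (simp add: csubspace_def)
    show "cinner (c *\<^sub>C x - c *\<^sub>C P x) s = 0" if "s \<in> S" for s
      using orth[OF that, of x] by (simp add: cinner_scaleC_left flip: scaleC_diff_right)
  qed
  have idem: "P (P x) = P x" for x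
    by (rule unique) (simp_all add: PS)
  have "bounded_linear P"
  proof (rule bounded_linear_intro)
    show "P (r *\<^sub>R x) = r *\<^sub>R P x" for r x
      by (simp add: scaleR_scaleC scale)
    show "norm (P x) \<le> norm x * 1" for x
    proof -
      \<comment> \<open>Pythagoras gives the operator bound 1.\<close>
      have "inner (x - P x) (P x) = 0"
        by (simp add: inner_eq_Re_cinner orth PS)
      then have "(norm (P x))\<^sup>2 + (norm (x - P x))\<^sup>2 = (norm x)\<^sup>2"
        by (simp add: power2_norm_eq_inner algebra_simps inner_commute)
      then have "(norm (P x))\<^sup>2 \<le> (norm x)\<^sup>2"
        using zero_le_power2[of "norm (x - P x)"] by linarith
      then have "norm (P x) \<le> norm x"
        by (rule power2_le_imp_le) simp
      then show ?thesis by simp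
    qed
  qed (rule add)
  then have "is_projection P"
    by (simp add: is_projection_def bounded_clinear_def scale idem comp_def fun_eq_iff)
  then show ?thesis using PS orth by (rule that)
qed

section \<open>Adjoints\<close>

text \<open>If \<open>f\<close> is nonzero, take a vector \<open>z\<close> orthogonal to the kernel
  with \<open>f z\<close> nonzero. Every \<open>y\<close> is a multiple of \<open>z\<close> plus a
  kernel vector, so a suitable multiple of \<open>z\<close> represents \<open>f\<close>.\<close>

lemma Riesz_representation:
  fixes f :: "'a::chilbert_space \<Rightarrow> complex"
  assumes f: "bounded_linear f" and scale: "\<And>c x. f (c *\<^sub>C x) = c * f x"
  obtains z where "\<And>x. f x = cinner x z"
proof (cases "\<forall>x. f x = 0")
  case True
  then show ?thesis by (intro that[of 0]) simp
next
  case False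
  then obtain x where x: "f x \<noteq> 0" by blast
  define S where "S = {x. f x = 0}"
  have add: "f (x + y) = f x + f y" and diff: "f (x - y) = f x - f y" for x y
    using f by (auto intro: linear_add linear_diff bounded_linear.linear)
  have "closed S"
    unfolding S_def
    by (intro closed_Collect_eq continuous_intros bounded_linear.continuous_on[OF f])
  moreover have "csubspace S"
    using add[of 0 0] by (simp add: S_def csubspace_def add scale)
  ultimately obtain p where "p \<in> S" and p: "\<And>s. s \<in> S \<Longrightarrow> cinner (x - p) s = 0"
    using closed_csubspace_orthogonal_decomposition by blast
  define z where "z = x - p"
  have fz: "f z \<noteq> 0"
    using x \<open>p \<in> S\<close> by (simp add: z_def diff S_def)
  then have zz: "cinner z z \<noteq> 0"
    using scale[of 0 z] add[of 0 0] by (auto simp: cinner_self_eq_0_iff)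
  \<comment> \<open>The scalar is fixed by the value at \<open>z\<close>; it is conjugated because
    \<open>cinner\<close> is conjugate-linear in its second argument.\<close>
  have "f y = cinner y (cnj (f z / cinner z z) *\<^sub>C z)" for y
  proof -
    have "y - (f y / f z) *\<^sub>C z \<in> S"
      using fz by (simp add: S_def diff scale)
    then have "cinner (y - (f y / f z) *\<^sub>C z) z = 0"
      using p by (simp add: z_def cinner_eq_0_commute)
    then have "cinner y z = f y / f z * cinner z z"
      by (simp add: cinner_diff_left cinner_scaleC_left)
    then show ?thesis
      using fz zz by (simp add: cinner_scaleC_right)
  qed
  then show ?thesis by (rule that)
qed

text \<open>Inner products with all vectors determine a vector, so at most one map satisfies the
  adjoint equation and any such map is the one selected by \<open>THE\<close>.\<close>

lemma cadjoint_eqI: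
  fixes T :: "'a::chilbert_space \<Rightarrow> 'b::chilbert_space"
  assumes "\<And>x y. cinner (T x) y = cinner x (S y)"
  shows "cadjoint T = S"
  unfolding cadjoint_def
proof (rule the_equality)
  fix R assume "\<forall>x y. cinner (T x) y = cinner x (R y)"
  then show "R = S"
    by (simp add: assms fun_eq_iff cinner_right_ext)
qed (use assms in blast)

text \<open>For each \<open>y\<close>, Riesz representation of the functional sending
  \<open>x\<close> to \<open>cinner (T x) y\<close> supplies the value of the adjoint at
  \<open>y\<close>.\<close>

lemma cinner_cadjoint_right:
  fixes T :: "'a::chilbert_space \<Rightarrow> 'b::chilbert_space"
  assumes "bounded_clinear T"
  shows "cinner x (cadjoint T y) = cinner (T x) y"
proof -
  have "\<exists>z. \<forall>x. cinner (T x) y = cinner x z" for y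
  proof -
    have "bounded_linear (\<lambda>x. cinner (T x) y)"
      using assms
      by (intro bounded_linear_compose[OF bounded_linear_cinner_left] bounded_clinear_bounded_linear)
    moreover have "cinner (T (c *\<^sub>C x)) y = c * cinner (T x) y" for c x
      by (simp add: bounded_clinear_scaleC[OF assms] cinner_scaleC_left)
    ultimately show ?thesis
      using Riesz_representation[of "\<lambda>x. cinner (T x) y"] by metis
  qed
  then obtain S where S: "\<And>x y. cinner (T x) y = cinner x (S y)"
    by metis
  then show ?thesis
    using cadjoint_eqI[of T S] by simp
qed

lemma cinner_cadjoint_left:
  assumes "bounded_clinear T"
  shows "cinner (cadjoint T y) x = cinner y (T x)"
  by (subst (1 2) cinner_commute) (simp add: cinner_cadjoint_right[OF assms])

lemma cadjoint_diff_right: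
  assumes "bounded_clinear T"
  shows "cadjoint T (x - y) = cadjoint T x - cadjoint T y"
  by (rule cinner_left_ext) (simp add: cinner_cadjoint_left[OF assms] cinner_diff_left)

lemma csubspace_range_cadjoint:
  assumes "bounded_clinear T"
  shows "csubspace (range (cadjoint T))"
proof (rule csubspace_range)
  show "cadjoint T (x + y) = cadjoint T x + cadjoint T y" for x y
    by (rule cinner_left_ext) (simp add: cinner_cadjoint_left[OF assms] cinner_add_left)
  show "cadjoint T (c *\<^sub>C x) = c *\<^sub>C cadjoint T x" for c x
    by (rule cinner_left_ext) (simp add: cinner_cadjoint_left[OF assms] cinner_scaleC_left)
qed

lemma cadjoint_comp:
  assumes "bounded_clinear S" and "bounded_clinear T"
  shows "cadjoint (S \<circ> T) = cadjoint T \<circ> cadjoint S"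
  by (rule cadjoint_eqI) (simp add: assms cinner_cadjoint_right)

text \<open>\<open>P\<close> is the orthogonal projection onto the closure of
  \<open>range T\<close>. The kernel of \<open>cadjoint T\<close> is the orthogonal complement of
  that range, so \<open>P\<close> annihilates it.\<close>

lemma range_projection_exists:
  fixes T :: "'a::chilbert_space \<Rightarrow> 'b::chilbert_space"
  assumes T: "bounded_clinear T"
  obtains P where "is_projection P" and "\<And>x. P (T x) = T x" and "\<And>y. cadjoint T y = 0 \<Longrightarrow> P y = 0"
proof -
  have "csubspace (range T)"
    by (intro csubspace_range bounded_clinear_add bounded_clinear_scaleC T)
  then obtain P where P: "is_projection P" and in_cl: "\<And>x. P x \<in> closure (range T)"
    and orth: "\<And>x s. s \<in> closure (range T) \<Longrightarrow> cinner (x - P x) s = 0"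
    using orthogonal_projection_exists[OF closed_closure csubspace_closure] by blast
  have range: "T x \<in> closure (range T)" for x
    by (rule subsetD[OF closure_subset rangeI])
  have fixes_range: "P (T x) = T x" for x
  proof -
    \<comment> \<open>The residue is orthogonal to \<open>T x\<close> and to \<open>P (T x)\<close>,
      both in the closure.\<close>
    have "cinner (T x - P (T x)) (T x - P (T x)) = 0"
      unfolding cinner_diff_right[of _ "T x"] using orth in_cl range by simp
    then show ?thesis by (simp add: cinner_self_eq_0_iff)
  qed
  have kernel: "P y = 0" if "cadjoint T y = 0" for y
  proof -
    have "closed {z. cinner z y = 0}"
      by (intro closed_Collect_eq continuous_intros
          bounded_linear.continuous_on[OF bounded_linear_cinner_left])
    moreover have "cinner (T x) y = 0" for x
      using that cinner_cadjoint_right[OF T, of x y] by simp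
    ultimately have "closure (range T) \<subseteq> {z. cinner z y = 0}"
      by (intro closure_minimal) auto
    \<comment> \<open>Both \<open>y\<close> and \<open>y - P y\<close> are orthogonal to
      \<open>P y\<close>, so \<open>P y\<close> is orthogonal to itself.\<close>
    then have "cinner y (P y) = 0"
      using in_cl by (auto simp: cinner_eq_0_commute[of y])
    moreover have "cinner (y - P y) (P y) = 0"
      by (rule orth[OF in_cl])
    ultimately show ?thesis
      by (simp add: cinner_diff_left cinner_self_eq_0_iff)
  qed
  from P fixes_range kernel show ?thesis by (rule that)
qed

text \<open>The residue \<open>x - Q x\<close> is orthogonal to \<open>range (cadjoint T)\<close>,
  hence lies in the kernel of \<open>T\<close>. Membership of \<open>Q x\<close> in the closure lets
  identities on \<open>range (cadjoint T)\<close> be extended to \<open>Q x\<close> by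
  continuity.\<close>

lemma corange_projection_exists:
  fixes T :: "'a::chilbert_space \<Rightarrow> 'b::chilbert_space"
  assumes T: "bounded_clinear T"
  obtains Q where "is_projection Q" and "\<And>x. T (Q x) = T x"
    and "\<And>x. Q x \<in> closure (range (cadjoint T))"
proof -
  obtain Q where Q: "is_projection Q" and in_cl: "\<And>x. Q x \<in> closure (range (cadjoint T))"
    and orth: "\<And>x s. s \<in> closure (range (cadjoint T)) \<Longrightarrow> cinner (x - Q x) s = 0"
    using orthogonal_projection_exists[OF closed_closure csubspace_closure]
      csubspace_range_cadjoint[OF T] by blast
  have "T (Q x) = T x" for x
  proof (rule cinner_left_ext)
    fix z
    have "cadjoint T z \<in> closure (range (cadjoint T))"
      by (rule subsetD[OF closure_subset rangeI])
    then have "cinner (T (x - Q x)) z = 0"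
      using orth cinner_cadjoint_right[OF T] by metis
    then show "cinner (T (Q x)) z = cinner (T x) z"
      by (simp add: bounded_clinear_diff[OF T] cinner_diff_left)
  qed
  with Q show ?thesis using in_cl by (rule that)
qed

section \<open>The operator orders\<close>

lemma star_le_imp_minus_le:
  assumes A: "bounded_clinear A" and B: "bounded_clinear B" and le: "star_le A B"
  shows "minus_le A B"
proof -
  obtain P where P: "is_projection P" "\<And>x. P (A x) = A x" "\<And>y. cadjoint A y = 0 \<Longrightarrow> P y = 0"
    using range_projection_exists[OF A] by blast
  obtain Q where Q: "is_projection Q" "\<And>x. A (Q x) = A x"
    "\<And>x. Q x \<in> closure (range (cadjoint A))"
    using corange_projection_exists[OF A] by blast
  have "P (B x) = A x" for x
  proof -
    have "cadjoint A (A x) = cadjoint A (B x)"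
      using le by (metis star_le_def comp_apply)
    then have "P (B x - A x) = 0"
      by (intro P(3)) (simp add: cadjoint_diff_right[OF A])
    then show ?thesis
      using P(1,2) by (simp add: is_projection_def bounded_clinear_diff)
  qed
  moreover have "B (Q x) = A x" for x
  proof -
    have "A (cadjoint A y) = B (cadjoint A y)" for y
      using le by (metis star_le_def comp_apply)
    then have "A (Q x) - B (Q x) = 0"
      using bounded_clinear_zero_on_closure[OF bounded_clinear_sub[OF A B] _ Q(3)] by auto
    then show ?thesis using Q(2) by simp
  qed
  ultimately have "A = P \<circ> B" "A = B \<circ> Q"
    by auto
  with P(1) Q(1) show ?thesis
    unfolding minus_le_def by blast
qed

text \<open>\<open>A = B \<circ> Q\<close> gives the inclusion of ranges, and the adjoint of
  \<open>A = P \<circ> B\<close> gives that of the adjoint ranges.\<close>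

lemma minus_le_imp_space_le:
  assumes "bounded_clinear B" and "minus_le A B"
  shows "space_le A B"
proof -
  obtain P Q where "is_projection P" and P: "A = P \<circ> B" and Q: "A = B \<circ> Q"
    using assms(2) unfolding minus_le_def by blast
  then have "cadjoint A = cadjoint B \<circ> cadjoint P"
    using assms(1) by (simp add: cadjoint_comp is_projection_def)
  then show ?thesis
    using Q by (auto simp: space_le_def)
qed

lemma minus_le_imp_plus_le:
  assumes "bounded_clinear B" and "minus_le A B"
  shows "plus_le A B"
proof -
  obtain P Q where PQ: "is_projection P" "is_projection Q" and P: "A = P \<circ> B" and Q: "A = B \<circ> Q"
    using assms(2) unfolding minus_le_def by blast
  \<comment> \<open>Replace \<open>P \<circ> B\<close> by \<open>A\<close> and then by
    \<open>B \<circ> Q\<close>; idempotence of \<open>Q\<close> collapses the result to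
    \<open>A\<close>.\<close>
  have "P \<circ> B \<circ> Q = B \<circ> (Q \<circ> Q)"
    using P Q by (simp add: o_assoc)
  then have "A = P \<circ> B \<circ> Q"
    using PQ(2) Q by (simp add: is_projection_def)
  then show ?thesis
    using PQ minus_le_imp_space_le[OF assms] by (auto simp: plus_le_def)
qed

text \<open>The operator \<open>A \<circ> cadjoint A\<close> is self-adjoint, so taking adjoints in
  its equation with \<open>B \<circ> cadjoint A\<close> turns the right side into
  \<open>A \<circ> cadjoint B\<close>; evaluating at \<open>A x\<close> gives the diamond equation.
  The space pre-order comes through the minus order.\<close>

lemma star_le_imp_diamond_le:
  assumes A: "bounded_clinear A" and B: "bounded_clinear B" and le: "star_le A B"
  shows "diamond_le A B"
proof -
  have eq: "A (cadjoint A y) = B (cadjoint A y)" for y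
    using le by (metis star_le_def comp_apply)
  have "A (cadjoint A y) = A (cadjoint B y)" for y
  proof (rule cinner_left_ext)
    fix z
    have "cinner (A (cadjoint A y)) z = cinner y (A (cadjoint A z))"
      using A by (simp add: cinner_cadjoint_left flip: cinner_cadjoint_right[OF A])
    also have "\<dots> = cinner (A (cadjoint B y)) z"
      using A B by (simp add: eq cinner_cadjoint_left flip: cinner_cadjoint_right[OF A])
    finally show "cinner (A (cadjoint A y)) z = cinner (A (cadjoint B y)) z" .
  qed
  then show ?thesis
    using minus_le_imp_space_le[OF B star_le_imp_minus_le[OF assms]]
    by (simp add: diamond_le_def fun_eq_iff)
qed

lemma diamond_le_imp_plus_le:
  assumes A: "bounded_clinear A" and B: "bounded_clinear B" and le: "diamond_le A B"
  shows "plus_le A B"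
proof -
  obtain P where P: "is_projection P" "\<And>x. P (A x) = A x" "\<And>y. cadjoint A y = 0 \<Longrightarrow> P y = 0"
    using range_projection_exists[OF A] by blast
  obtain Q where Q: "is_projection Q" "\<And>x. A (Q x) = A x"
    "\<And>x. Q x \<in> closure (range (cadjoint A))"
    using corange_projection_exists[OF A] by blast
  have eq: "A (cadjoint A (A x)) = A (cadjoint B (A x))" for x
    using le by (metis diamond_le_def comp_apply)
  \<comment> \<open>This is the adjoint of the diamond equation, verified by testing against
    \<open>z\<close>.\<close>
  have adj: "cadjoint A (A (cadjoint A y)) = cadjoint A (B (cadjoint A y))" for y
  proof (rule cinner_right_ext)
    fix z
    have "cinner z (cadjoint A (A (cadjoint A y))) = cinner (A (cadjoint A (A z))) y"
      using A by (simp add: cinner_cadjoint_right flip: cinner_cadjoint_left)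
    also have "\<dots> = cinner z (cadjoint A (B (cadjoint A y)))"
      using A B by (simp add: eq cinner_cadjoint_right flip: cinner_cadjoint_left)
    finally show "cinner z (cadjoint A (A (cadjoint A y))) = cinner z (cadjoint A (B (cadjoint A y)))" .
  qed
  have P_lin: "bounded_clinear P"
    using P(1) by (simp add: is_projection_def)
  \<comment> \<open>By \<open>adj\<close>, \<open>A - B\<close> maps
    \<open>range (cadjoint A)\<close> into the kernel of \<open>cadjoint A\<close>, where
    \<open>P\<close> vanishes; continuity extends this to the closure, which contains
    \<open>Q x\<close>.\<close>
  have "P (A (Q x) - B (Q x)) = 0" for x
  proof (rule bounded_clinear_zero_on_closure[OF _ _ Q(3)])
    show "bounded_clinear (\<lambda>x. P (A x - B x))"
      by (intro bounded_clinear_compose[OF P_lin] bounded_clinear_sub A B)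
    show "P (A y - B y) = 0" if "y \<in> range (cadjoint A)" for y
      using that adj by (intro P(3)) (auto simp: cadjoint_diff_right[OF A])
  qed
  then have "A x = P (B (Q x))" for x
    using P(2) Q(2) by (simp add: bounded_clinear_diff[OF P_lin])
  then have "A = P \<circ> B \<circ> Q"
    by auto
  then show ?thesis
    using P(1) Q(1) le by (auto simp: plus_le_def diamond_le_def)
qed

theorem lemma3p9:
  fixes A B :: "'h::chilbert_space \<Rightarrow> 'k::chilbert_space"
  assumes "bounded_clinear A" and "bounded_clinear B"
  shows "((star_le A B \<longrightarrow> minus_le A B) \<and>
          (minus_le A B \<longrightarrow> plus_le A B) \<and>
          (plus_le A B \<longrightarrow> space_le A B)) \<and>
         ((star_le A B \<longrightarrow> diamond_le A B) \<and>
          (diamond_le A B \<longrightarrow> plus_le A B) \<and>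
          (plus_le A B \<longrightarrow> space_le A B))"
  using star_le_imp_minus_le[OF assms] minus_le_imp_plus_le[OF assms(2), of A]
    star_le_imp_diamond_le[OF assms] diamond_le_imp_plus_le[OF assms]
  by (simp add: plus_le_def[of A B])

end
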